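(* Let $0<k<n$ and define $\pi_k:\mathbb{C}\to\mathbb{R}\times\mathbb{C}$ by $\pi_k(\lambda)=(k/n,\,k\lambda/n)$. Then $\pi_k$ is an affine map that restricts to a bijection from $W_k(c)$ onto $I_{k/n}$.
   Context: Let $c$ be a linear operator on an $n$-dimensional complex Hilbert space $H$, let $B(H)$ be the algebra of all linear operators on $H$, and let $\tau$ be the normalized trace on $B(H)$ (so $\tau(1)=1$). Define $\Psi(a)=(\tau(a),\tau(ca))\in\mathbb{R}\times\mathbb{C}$ for self-adjoint $a\in B(H)$. The spectral scale of $c$ is $B=\{\Psi(a): a\in B(H),\ 0\le a\le 1\}\subset\mathbb{R}\times\mathbb{C}$. For $0\le t\le 1$ the isotrace slice of $B$ at $t$ is $I_t=\{(x_0,z)\in B: x_0=t\}$. The $k$-numerical range of $c$ is $W_k(c)=\left\{\frac1k\sum_{i=1}^k\langle c\mathbf{x}_i,\mathbf{x}_i\rangle:\ \mathbf{x}_1,\dots,\mathbf{x}_k\in H \text{ orthonormal}\right\}$. *)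

theory Defs
  imports "HOL-Analysis.Analysis"
begin

text \<open>
  A finite-dimensional complex Hilbert space whose carrier is the whole type. Completeness is
  automatic in finite dimension. The inner product is linear in its first argument.
  \<open>Basis\<close> is an arbitrary vector space basis, not assumed orthonormal; it only serves
  to write down the trace, which does not depend on it.
\<close>

locale complex_hilbert = finite_dimensional_vector_space scale Basis
  for scale :: "complex \<Rightarrow> 'a::ab_group_add \<Rightarrow> 'a"  (infixr \<open>*c\<close> 75)
  and Basis :: "'a set" +
  fixes ip :: "'a \<Rightarrow> 'a \<Rightarrow> complex"
  assumes ip_add_left: "ip (x + y) z = ip x z + ip y z"
    and ip_scale_left: "ip (r *c x) y = r * ip x y"
    and ip_commute: "ip x y = cnj (ip y x)"
    and ip_pos: "x \<noteq> 0 \<Longrightarrow> 0 < Re (ip x x)"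
begin

definition linear_op :: "('a \<Rightarrow> 'a) \<Rightarrow> bool" where
  "linear_op a \<longleftrightarrow> Vector_Spaces.linear scale scale a"

definition self_adjoint :: "('a \<Rightarrow> 'a) \<Rightarrow> bool" where
  "self_adjoint a \<longleftrightarrow> linear_op a \<and> (\<forall>x y. ip (a x) y = ip x (a y))"

definition positive_op :: "('a \<Rightarrow> 'a) \<Rightarrow> bool" where
  "positive_op a \<longleftrightarrow> self_adjoint a \<and> (\<forall>x. 0 \<le> Re (ip (a x) x))"

definition op_le :: "('a \<Rightarrow> 'a) \<Rightarrow> ('a \<Rightarrow> 'a) \<Rightarrow> bool" where
  "op_le a b \<longleftrightarrow> positive_op (\<lambda>x. b x - a x)"

definition op_trace :: "('a \<Rightarrow> 'a) \<Rightarrow> complex" where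
  "op_trace a = (\<Sum>b\<in>Basis. representation Basis (a b) b)"

definition ntrace :: "('a \<Rightarrow> 'a) \<Rightarrow> complex" where
  "ntrace a = op_trace a / of_nat (dim UNIV)"

text \<open>Only applied to self-adjoint \<open>a\<close>, for which \<open>ntrace a\<close> is real.\<close>

definition Psi :: "('a \<Rightarrow> 'a) \<Rightarrow> ('a \<Rightarrow> 'a) \<Rightarrow> real \<times> complex" where
  "Psi c a = (Re (ntrace a), ntrace (c \<circ> a))"

definition spectral_scale :: "('a \<Rightarrow> 'a) \<Rightarrow> (real \<times> complex) set" where
  "spectral_scale c = {Psi c a | a. self_adjoint a \<and> op_le (\<lambda>x. 0) a \<and> op_le a id}"

definition isotrace_slice :: "('a \<Rightarrow> 'a) \<Rightarrow> real \<Rightarrow> (real \<times> complex) set" where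
  "isotrace_slice c t = {(x0, z). (x0, z) \<in> spectral_scale c \<and> x0 = t}"

definition k_numerical_range :: "nat \<Rightarrow> ('a \<Rightarrow> 'a) \<Rightarrow> complex set" where
  "k_numerical_range k c =
    {1 / of_nat k * (\<Sum>i=1..k. ip (c (x i)) (x i)) | x :: nat \<Rightarrow> 'a.
      \<forall>i\<in>{1..k}. \<forall>j\<in>{1..k}. ip (x i) (x j) = (if i = j then 1 else 0)}"

end

text \<open>Affine over the reals, since the codomain is \<open>real \<times> complex\<close>.\<close>

definition affine_map :: "('v::real_vector \<Rightarrow> 'w::real_vector) \<Rightarrow> bool" where
  "affine_map f \<longleftrightarrow> (\<exists>L v. linear L \<and> (\<forall>x. f x = L x + v))"

definition slice_map :: "nat \<Rightarrow> nat \<Rightarrow> complex \<Rightarrow> real \<times> complex" where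
  "slice_map n k l = (real k / real n, of_nat k * l / of_nat n)"

end

theory Submission
  imports Defs "HOL-Computational_Algebra.Fundamental_Theorem_Algebra"
begin

text \<open>
  The image of \<open>W\<^sub>k(c)\<close> consists of the points \<open>Psi c p\<close> with \<open>p\<close> a projection of rank \<open>k\<close>,
  whereas the slice consists of the points \<open>Psi c a\<close> with \<open>0 \<le> a \<le> 1\<close> and trace \<open>k\<close>. That the image
  lies in the slice, and that the map is affine and injective (its linear part is multiplication by
  \<open>k/n \<noteq> 0\<close>), is direct. The content is that every such \<open>a\<close> can be replaced by a projection \<open>p\<close> of the
  same trace with \<open>tr(cp) = tr(ca)\<close>.

  By the spectral theorem, \<open>a\<close> is a sum of rank-one projections onto orthonormal vectors \<open>e\<close>, with
  weights \<open>l e \<in> [0,1]\<close> that sum to \<open>k\<close>; then \<open>tr(ca)\<close> is the sum of the \<open>l e * \<langle>c e, e\<rangle>\<close>. If two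
  of the weights are fractional, say those of \<open>u\<close> and \<open>v\<close>, then the plane spanned by \<open>u\<close> and \<open>v\<close> has
  another orthonormal basis, with new weights of the same sum, such that one new weight is 0 or 1 and
  the contribution of the plane to \<open>tr(ca)\<close> has not changed (\<open>plane_exchange\<close>). This is the
  Toeplitz-Hausdorff theorem for a two-dimensional compression of \<open>c\<close>, combined with the fact that the
  trace of the compression does not depend on the basis. Each exchange lowers the number of fractional
  weights. As soon as at most one is left there is none, because the sum of the weights is the integer
  \<open>k\<close>; the vectors of weight 1 then span the range of \<open>p\<close> (\<open>round_weights_to_subset\<close>).
\<close>

context complex_hilbert
begin

section \<open>Inner product and linear operators\<close>

lemma ip_add_right: "ip x (y + z) = ip x y + ip x z"
  by (metis complex_cnj_add ip_add_left ip_commute)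

lemma ip_scale_right: "ip x (r *c y) = cnj r * ip x y"
  by (metis complex_cnj_mult ip_commute ip_scale_left)

lemma ip_zero_left [simp]: "ip 0 y = 0"
  using ip_add_left[of 0 0 y] by simp

lemma ip_zero_right [simp]: "ip x 0 = 0"
  using ip_add_right[of x 0 0] by simp

lemma ip_minus_left: "ip (- x) y = - ip x y"
  using ip_add_left[of x "- x" y] by (simp add: eq_neg_iff_add_eq_0 add.commute)

lemma ip_minus_right: "ip x (- y) = - ip x y"
  using ip_add_right[of x y "- y"] by (simp add: eq_neg_iff_add_eq_0 add.commute)

lemma ip_diff_left: "ip (x - y) z = ip x z - ip y z"
  using ip_add_left[of x "- y" z] by (simp add: ip_minus_left)

lemma ip_diff_right: "ip x (y - z) = ip x y - ip x z"
  using ip_add_right[of x y "- z"] by (simp add: ip_minus_right)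

lemma ip_sum_left: "ip (\<Sum>i\<in>I. f i) y = (\<Sum>i\<in>I. ip (f i) y)"
  by (induction I rule: infinite_finite_induct) (auto simp: ip_add_left)

lemma ip_sum_right: "ip x (\<Sum>i\<in>I. f i) = (\<Sum>i\<in>I. ip x (f i))"
  by (induction I rule: infinite_finite_induct) (auto simp: ip_add_right)

lemma ip_self_real: "ip x x = of_real (Re (ip x x))"
proof -
  have "ip x x = cnj (ip x x)" by (rule ip_commute)
  then have "Im (ip x x) = 0" by (metis Reals_cnj_iff complex_is_Real_iff)
  then show ?thesis by (simp add: complex_eq_iff)
qed

lemma ip_self_nonneg: "0 \<le> Re (ip x x)"
  by (cases "x = 0") (auto intro: less_imp_le ip_pos)

lemma linear_op_add: "linear_op a \<Longrightarrow> a (x + y) = a x + a y"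
  unfolding linear_op_def by (simp add: linear_iff_module_hom module_hom.add)

lemma linear_op_scale: "linear_op a \<Longrightarrow> a (r *c x) = r *c a x"
  unfolding linear_op_def by (simp add: linear_iff_module_hom module_hom.scale)

lemma linear_op_diff: "linear_op a \<Longrightarrow> a (x - y) = a x - a y"
  unfolding linear_op_def by (simp add: linear_iff_module_hom module_hom.diff)

lemma linear_op_sum: "linear_op a \<Longrightarrow> a (\<Sum>i\<in>I. f i) = (\<Sum>i\<in>I. a (f i))"
  unfolding linear_op_def by (simp add: linear_iff_module_hom module_hom.sum)

lemma linear_opI:
  "(\<And>x y. a (x + y) = a x + a y) \<Longrightarrow> (\<And>r x. a (r *c x) = r *c a x) \<Longrightarrow> linear_op a"
  unfolding linear_op_def
  by (intro module_hom_iff_linear[THEN iffD1]) (unfold_locales, auto)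

section \<open>Orthonormal sets and the trace\<close>

definition orthonormal :: "'a set \<Rightarrow> bool" where
  "orthonormal E \<longleftrightarrow> (\<forall>x\<in>E. \<forall>y\<in>E. ip x y = (if x = y then 1 else 0))"

lemma orthonormal_coefficient:
  assumes "orthonormal E" "finite F" "F \<subseteq> E" "e \<in> F"
  shows "ip (\<Sum>x\<in>F. f x *c x) e = f e"
proof -
  have "ip (\<Sum>x\<in>F. f x *c x) e = (\<Sum>x\<in>F. f x * ip x e)"
    by (simp add: ip_sum_left ip_scale_left)
  also have "\<dots> = (\<Sum>x\<in>F. if x = e then f x else 0)"
    using assms by (intro sum.cong) (auto simp: orthonormal_def subset_iff)
  finally show ?thesis using assms by simp
qed

lemma orthonormal_independent:
  assumes "orthonormal E"
  shows "independent E"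
  unfolding independent_explicit_module
  using orthonormal_coefficient[OF assms] by (metis ip_zero_left)

lemma orthonormal_finite: "orthonormal E \<Longrightarrow> finite E"
  by (rule finiteI_independent[OF orthonormal_independent])

lemma orthonormal_card: "orthonormal E \<Longrightarrow> card E \<le> dim (UNIV :: 'a set)"
  by (rule independent_card_le_dim[OF subset_UNIV orthonormal_independent])

lemma orthonormal_insert:
  assumes "orthonormal E" "ip u u = 1" "\<And>e. e \<in> E \<Longrightarrow> ip u e = 0"
  shows "orthonormal (insert u E)"
proof -
  have "ip e u = 0" if "e \<in> E" for e
    using assms(3)[OF that] ip_commute[of e u] by simp
  moreover have "u \<notin> E" using assms(2,3) by fastforce
  ultimately show ?thesis using assms unfolding orthonormal_def by auto
qed

text \<open>For one summand, the coefficients of \<open>w\<close> in \<open>Basis\<close>, weighted by \<open>\<langle>b, x\<rangle>\<close>, reassemble to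
  \<open>\<langle>w, x\<rangle>\<close>. So traces can be read off from any decomposition into operators of rank one, without
  comparing \<open>Basis\<close> with an orthonormal basis.\<close>

lemma op_trace_sum_rank_one:
  "op_trace (\<lambda>y. \<Sum>i\<in>I. ip y (x i) *c w i) = (\<Sum>i\<in>I. ip (w i) (x i))"
proof -
  have "op_trace (\<lambda>y. \<Sum>i\<in>I. ip y (x i) *c w i)
      = (\<Sum>b\<in>Basis. \<Sum>i\<in>I. ip b (x i) * representation Basis (w i) b)"
    unfolding op_trace_def
    by (simp add: representation_sum representation_scale independent_Basis span_Basis)
  also have "\<dots> = (\<Sum>i\<in>I. \<Sum>b\<in>Basis. representation Basis (w i) b * ip b (x i))"
    by (subst sum.swap) (simp add: mult.commute)
  also have "\<dots> = (\<Sum>i\<in>I. ip (\<Sum>b\<in>Basis. representation Basis (w i) b *c b) (x i))"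
    by (simp add: ip_sum_left ip_scale_left)
  also have "\<dots> = (\<Sum>i\<in>I. ip (w i) (x i))"
    by (simp add: sum_representation_eq independent_Basis span_Basis finite_Basis)
  finally show ?thesis .
qed

text \<open>For orthonormal \<open>E\<close> this is the operator with eigenvectors \<open>e \<in> E\<close>, eigenvalues \<open>l e\<close>, and
  value 0 on the orthogonal complement of \<open>E\<close>. Weights constantly 1 give the orthogonal projection
  onto the span of \<open>E\<close>.\<close>

definition diagonal_op :: "'a set \<Rightarrow> ('a \<Rightarrow> real) \<Rightarrow> 'a \<Rightarrow> 'a" where
  "diagonal_op E l y = (\<Sum>e\<in>E. ip y e *c (of_real (l e) *c e))"

lemma linear_op_diagonal_op: "linear_op (diagonal_op E l)"
  by (rule linear_opI)
    (simp_all add: diagonal_op_def ip_add_left ip_scale_left scale_left_distrib distrib_right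
      sum.distrib scale_sum_right mult.assoc)

lemma self_adjoint_diagonal_op: "self_adjoint (diagonal_op E l)"
  unfolding self_adjoint_def
proof (intro conjI linear_op_diagonal_op allI)
  fix x y
  have "ip x e * (of_real (l e) * ip e y) = cnj (ip y e) * (of_real (l e) * ip x e)" for e
    using ip_commute[of e y] by (simp add: mult.commute mult.left_commute)
  then show "ip (diagonal_op E l x) y = ip x (diagonal_op E l y)"
    by (simp only: diagonal_op_def ip_sum_left ip_sum_right ip_scale_left ip_scale_right
        complex_cnj_complex_of_real)
qed

lemma ip_diagonal_op: "ip (diagonal_op E l x) x = of_real (\<Sum>e\<in>E. l e * (cmod (ip x e))\<^sup>2)"
proof -
  have "ip x e * (of_real (l e) * ip e x) = of_real (l e * (cmod (ip x e))\<^sup>2)" for e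
    using ip_commute[of e x] complex_norm_square[of "ip x e"]
    by (simp add: mult.commute mult.left_commute)
  then show ?thesis
    by (simp only: diagonal_op_def ip_sum_left ip_scale_left of_real_sum)
qed

text \<open>Expanding \<open>0 \<le> \<langle>x - p, x - p\<rangle>\<close>, where \<open>p\<close> is the orthogonal projection of \<open>x\<close> onto the span of
  \<open>E\<close>.\<close>

lemma bessel_inequality:
  assumes "orthonormal E"
  shows "(\<Sum>e\<in>E. (cmod (ip x e))\<^sup>2) \<le> Re (ip x x)"
proof -
  define p where "p = diagonal_op E (\<lambda>_. 1) x"
  define S where "S = (\<Sum>e\<in>E. (cmod (ip x e))\<^sup>2)"
  have px: "ip p x = of_real S"
    unfolding p_def S_def by (simp add: ip_diagonal_op)
  have pe: "ip p e = ip x e" if "e \<in> E" for e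
    using orthonormal_coefficient[OF assms orthonormal_finite[OF assms] subset_refl that]
    by (simp add: p_def diagonal_op_def)
  have "ip p p = (\<Sum>e\<in>E. ip x e * ip e p)"
    by (subst (1) p_def) (simp add: diagonal_op_def ip_sum_left ip_scale_left)
  also have "\<dots> = (\<Sum>e\<in>E. ip x e * ip e x)"
    by (intro sum.cong refl) (metis pe ip_commute)
  also have "\<dots> = ip p x"
    by (simp add: p_def diagonal_op_def ip_sum_left ip_scale_left)
  finally have pp: "ip p p = of_real S" using px by simp
  have xp: "ip x p = of_real S"
    using px ip_commute[of x p] by simp
  have "Re (ip (x - p) (x - p)) = Re (ip x x) - S"
    by (simp add: ip_diff_left ip_diff_right pp xp px)
  with ip_self_nonneg[of "x - p"] show ?thesis by (simp add: S_def)
qed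

lemma diagonal_op_effect:
  assumes "orthonormal E" "l ` E \<subseteq> {0..1}"
  shows "op_le (\<lambda>x. 0) (diagonal_op E l)" "op_le (diagonal_op E l) id"
proof -
  have l: "0 \<le> l e \<and> l e \<le> 1" if "e \<in> E" for e
    using assms(2) that by auto
  show "op_le (\<lambda>x. 0) (diagonal_op E l)"
    using self_adjoint_diagonal_op[of E l] l
    by (auto simp: op_le_def positive_op_def ip_diagonal_op intro!: sum_nonneg)
  have "(\<Sum>e\<in>E. l e * (cmod (ip x e))\<^sup>2) \<le> Re (ip x x)" for x
  proof -
    have "(\<Sum>e\<in>E. l e * (cmod (ip x e))\<^sup>2) \<le> (\<Sum>e\<in>E. (cmod (ip x e))\<^sup>2)"
      using l by (intro sum_mono) (simp add: mult_left_le_one_le)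
    then show ?thesis using bessel_inequality[OF assms(1), of x] by linarith
  qed
  moreover have "self_adjoint (\<lambda>x. id x - diagonal_op E l x)"
    using self_adjoint_diagonal_op[of E l]
    by (auto simp: self_adjoint_def ip_diff_left ip_diff_right linear_op_add linear_op_scale
        scale_right_diff_distrib intro!: linear_opI)
  ultimately show "op_le (diagonal_op E l) id"
    by (simp add: op_le_def positive_op_def ip_diff_left ip_diagonal_op)
qed

lemma op_trace_compose_diagonal_op:
  assumes "linear_op c"
  shows "op_trace (c \<circ> diagonal_op E l) = (\<Sum>e\<in>E. of_real (l e) * ip (c e) e)"
proof -
  have "c \<circ> diagonal_op E l = (\<lambda>y. \<Sum>e\<in>E. ip y e *c (of_real (l e) *c c e))"
    by (auto simp: diagonal_op_def linear_op_sum[OF assms] linear_op_scale[OF assms])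
  then show ?thesis
    by (simp only: op_trace_sum_rank_one ip_scale_left)
qed

lemma op_trace_diagonal_op:
  assumes "orthonormal E"
  shows "op_trace (diagonal_op E l) = of_real (sum l E)"
proof -
  have "op_trace (diagonal_op E l) = (\<Sum>e\<in>E. ip (of_real (l e) *c e) e)"
    by (simp only: diagonal_op_def[abs_def] op_trace_sum_rank_one)
  also have "\<dots> = (\<Sum>e\<in>E. of_real (l e))"
    using assms by (intro sum.cong) (auto simp: ip_scale_left orthonormal_def)
  finally show ?thesis by simp
qed

section \<open>The spectral theorem\<close>

definition apply_poly :: "('a \<Rightarrow> 'a) \<Rightarrow> complex poly \<Rightarrow> 'a \<Rightarrow> 'a" where
  "apply_poly a p v = (\<Sum>i\<le>degree p. coeff p i *c (a ^^ i) v)"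

lemma apply_poly_bound:
  assumes "degree p \<le> N"
  shows "apply_poly a p v = (\<Sum>i\<le>N. coeff p i *c (a ^^ i) v)"
  unfolding apply_poly_def using assms
  by (intro sum.mono_neutral_left) (auto simp: coeff_eq_0)

lemma apply_poly_factor:
  assumes "linear_op a"
  shows "apply_poly a ([:- m, 1:] * q) v = apply_poly a q (a v - m *c v)"
proof -
  let ?p = "[:- m, 1:] * q"
  have lin: "(a ^^ i) (a v - m *c v) = (a ^^ Suc i) v - m *c (a ^^ i) v" for i
    by (induction i) (auto simp: linear_op_diff[OF assms] linear_op_scale[OF assms])
  have deg: "degree ?p \<le> Suc (degree q)"
    using degree_mult_le[of "[:- m, 1:]" q] by simp
  have "apply_poly a ?p v = (\<Sum>i\<le>Suc (degree q). coeff ?p i *c (a ^^ i) v)"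
    by (rule apply_poly_bound[OF deg])
  also have "\<dots> = (\<Sum>i\<le>Suc (degree q). coeff (pCons 0 q) i *c (a ^^ i) v)
      - (\<Sum>i\<le>Suc (degree q). (m * coeff q i) *c (a ^^ i) v)"
    by (simp add: scale_left_diff_distrib sum_subtractf del: sum.atMost_Suc)
  also have "(\<Sum>i\<le>Suc (degree q). coeff (pCons 0 q) i *c (a ^^ i) v)
      = (\<Sum>i\<le>degree q. coeff q i *c (a ^^ Suc i) v)"
    by (subst sum.atMost_Suc_shift) simp
  also have "(\<Sum>i\<le>Suc (degree q). (m * coeff q i) *c (a ^^ i) v)
      = (\<Sum>i\<le>degree q. coeff q i *c (m *c (a ^^ i) v))"
    by (simp add: coeff_eq_0 mult.commute)
  finally show ?thesis
    by (simp only: apply_poly_def lin scale_right_diff_distrib sum_subtractf)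
qed

text \<open>Split off a linear factor \<open>X - m\<close> of \<open>p\<close>: either \<open>v\<close> is an eigenvector for \<open>m\<close>, or
  \<open>a v - m v\<close> is a nonzero vector of \<open>S\<close> that is annihilated by the quotient polynomial.\<close>

lemma eigenvector_if_annihilated:
  assumes "linear_op a" "subspace S" "\<And>x. x \<in> S \<Longrightarrow> a x \<in> S"
    and "p \<noteq> 0" "apply_poly a p v = 0" "v \<in> S" "v \<noteq> 0"
  shows "\<exists>u\<in>S. u \<noteq> 0 \<and> (\<exists>m. a u = m *c u)"
  using assms(4-7)
proof (induction "degree p" arbitrary: p v)
  case 0
  then have "coeff p 0 \<noteq> 0" by (metis leading_coeff_0_iff)
  with 0 show ?case by (simp add: apply_poly_def)
next
  case (Suc d)
  obtain m where "poly p m = 0"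
    using fundamental_theorem_of_algebra[of p] Suc.hyps by (auto simp: constant_degree)
  then obtain q where p: "p = [:- m, 1:] * q"
    by (auto simp: poly_eq_0_iff_dvd)
  with Suc have q: "q \<noteq> 0" by auto
  have dq: "d = degree q"
    using Suc.hyps q unfolding p by (subst (asm) degree_mult_eq) auto
  let ?w = "a v - m *c v"
  have wS: "?w \<in> S"
    using Suc.prems assms(2,3) by (simp add: subspace_diff subspace_scale)
  show ?case
  proof (cases "?w = 0")
    case True
    then have "a v = m *c v" by simp
    with Suc.prems show ?thesis by blast
  next
    case False
    have "apply_poly a q ?w = 0"
      using Suc.prems(2) apply_poly_factor[OF assms(1)] p by simp
    with Suc.hyps(1)[OF dq q _ wS False] show ?thesis by blast
  qed
qed

text \<open>Stated for a family rather than a set, since the iterates of an operator on a vector may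
  repeat; a repetition is a linear relation as well.\<close>

lemma linear_relation_exists:
  fixes x :: "nat \<Rightarrow> 'a"
  shows "\<exists>f. (\<exists>i\<le>dim (UNIV :: 'a set). f i \<noteq> 0)
    \<and> (\<Sum>i\<le>dim (UNIV :: 'a set). f i *c x i) = 0"
proof -
  let ?N = "dim (UNIV :: 'a set)"
  show ?thesis
  proof (cases "inj_on x {..?N}")
    case True
    then have "card (x ` {..?N}) = Suc ?N" by (simp add: card_image)
    then have "dependent (x ` {..?N})"
      using independent_card_le_dim[OF subset_UNIV, of "x ` {..?N}"] by auto
    then obtain g where g: "\<exists>v\<in>x ` {..?N}. g v \<noteq> 0" "(\<Sum>v\<in>x ` {..?N}. g v *c v) = 0"
      by (auto simp: dependent_finite)
    have "(\<Sum>i\<le>?N. g (x i) *c x i) = 0"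
      using g(2) unfolding sum.reindex[OF True] o_def .
    with g(1) show ?thesis by (intro exI[of _ "\<lambda>i. g (x i)"]) auto
  next
    case False
    then obtain i j where ij: "i \<le> ?N" "j \<le> ?N" "i \<noteq> j" "x i = x j"
      by (auto simp: inj_on_def)
    let ?f = "\<lambda>h. (if h = i then 1 else 0) - (if h = j then 1 else 0) :: complex"
    have "(\<Sum>h\<le>?N. ?f h *c x h)
        = (\<Sum>h\<le>?N. if h = i then x h else 0) - (\<Sum>h\<le>?N. if h = j then x h else 0)"
      unfolding sum_subtractf[symmetric]
      by (intro sum.cong) (auto simp: scale_left_diff_distrib)
    also have "\<dots> = 0" using ij by simp
    finally show ?thesis using ij by (intro exI[of _ ?f]) auto
  qed
qed

lemma eigenvector_in_invariant_subspace:
  assumes "linear_op a" "subspace S" "\<And>x. x \<in> S \<Longrightarrow> a x \<in> S" "v \<in> S" "v \<noteq> 0"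
  shows "\<exists>u\<in>S. u \<noteq> 0 \<and> (\<exists>m. a u = m *c u)"
proof -
  let ?N = "dim (UNIV :: 'a set)"
  obtain f where f: "\<exists>i\<le>?N. f i \<noteq> 0" "(\<Sum>i\<le>?N. f i *c (a ^^ i) v) = 0"
    using linear_relation_exists[of "\<lambda>i. (a ^^ i) v"] by blast
  define p where "p = (\<Sum>i\<le>?N. monom (f i) i)"
  have cp: "coeff p i = (if i \<le> ?N then f i else 0)" for i
    unfolding p_def by (simp add: coeff_sum)
  have "p \<noteq> 0"
  proof
    assume "p = 0"
    with f(1) cp show False by (metis coeff_0)
  qed
  moreover have "apply_poly a p v = 0"
  proof -
    have "degree p \<le> ?N" by (rule degree_le) (simp add: cp)
    then show ?thesis using f(2) by (simp add: apply_poly_bound cp)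
  qed
  ultimately show ?thesis
    using eigenvector_if_annihilated[OF assms(1-3) _ _ assms(4,5)] by blast
qed

lemma normalize_vector:
  assumes "x \<noteq> 0"
  obtains r where "ip (r *c x) (r *c x) = 1"
proof -
  let ?r = "complex_of_real (1 / sqrt (Re (ip x x)))"
  have pos: "0 < Re (ip x x)" by (rule ip_pos[OF assms])
  have "ip (?r *c x) (?r *c x) = ?r * ?r * of_real (Re (ip x x))"
    using ip_self_real[of x] by (simp add: ip_scale_left ip_scale_right)
  also have "\<dots> = complex_of_real (1 / sqrt (Re (ip x x)) * (1 / sqrt (Re (ip x x))) * Re (ip x x))"
    by (simp only: of_real_mult)
  also have "1 / sqrt (Re (ip x x)) * (1 / sqrt (Re (ip x x))) * Re (ip x x) = 1"
    using pos by simp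
  finally have "ip (?r *c x) (?r *c x) = 1" by (simp only: of_real_1)
  then show thesis by (rule that)
qed

text \<open>Choose an orthonormal set \<open>E\<close> of eigenvectors of maximal size. Its orthogonal complement is
  invariant because \<open>a\<close> is self-adjoint, so if it were nonzero it would contain an eigenvector, and
  \<open>E\<close> could be enlarged. Hence \<open>E\<close> is an orthonormal basis.\<close>

theorem spectral_theorem:
  assumes "self_adjoint a"
  obtains E l where "orthonormal E" "\<And>e. e \<in> E \<Longrightarrow> a e = of_real (l e) *c e"
    "a = diagonal_op E l"
proof -
  have lin: "linear_op a" and sa: "\<And>x y. ip (a x) y = ip x (a y)"
    using assms by (auto simp: self_adjoint_def)
  define good where "good E \<longleftrightarrow> orthonormal E \<and> (\<forall>e\<in>E. \<exists>m. a e = m *c e)" for E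
  have "\<exists>E. good E \<and> (\<forall>F. good F \<longrightarrow> card F \<le> card E)"
  proof (rule ex_has_greatest_nat)
    show "good {}" by (simp add: good_def orthonormal_def)
    show "\<forall>F. good F \<longrightarrow> card F < Suc (dim (UNIV :: 'a set))"
      using orthonormal_card by (auto simp: good_def less_Suc_eq_le simp del: dim_UNIV)
  qed
  then obtain E where E: "orthonormal E" and eig: "\<And>e. e \<in> E \<Longrightarrow> \<exists>m. a e = m *c e"
    and max: "\<And>F. good F \<Longrightarrow> card F \<le> card E"
    by (auto simp: good_def)
  have fin: "finite E" by (rule orthonormal_finite[OF E])
  define S where "S = {y. \<forall>e\<in>E. ip y e = 0}"
  have S: "subspace S"
    by (auto simp: subspace_def S_def ip_add_left ip_scale_left)
  have inv: "a x \<in> S" if "x \<in> S" for x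
    unfolding S_def
  proof (intro CollectI ballI)
    fix e assume "e \<in> E"
    with eig obtain m where "a e = m *c e" by blast
    with that \<open>e \<in> E\<close> show "ip (a x) e = 0" by (simp add: sa ip_scale_right S_def)
  qed
  have zero: "y = 0" if yS: "y \<in> S" for y
  proof (rule ccontr)
    assume "y \<noteq> 0"
    then obtain u m where u: "u \<in> S" "u \<noteq> 0" "a u = m *c u"
      using eigenvector_in_invariant_subspace[OF lin S inv yS] by blast
    obtain r where r: "ip (r *c u) (r *c u) = 1" using normalize_vector[OF u(2)] .
    have "good (insert (r *c u) E)"
      unfolding good_def
    proof (intro conjI ballI)
      show "orthonormal (insert (r *c u) E)"
        using u(1) by (intro orthonormal_insert[OF E r]) (auto simp: S_def ip_scale_left)
      fix e assume "e \<in> insert (r *c u) E"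
      then show "\<exists>m. a e = m *c e"
        using eig u(3) by (auto simp: linear_op_scale[OF lin] mult.commute)
    qed
    moreover have "r *c u \<notin> E"
    proof
      assume "r *c u \<in> E"
      then have "ip u (r *c u) = 0" using u(1) by (simp add: S_def)
      then show False using r by (simp add: ip_scale_left)
    qed
    ultimately show False using max[of "insert (r *c u) E"] fin by simp
  qed
  have expand: "y = (\<Sum>e\<in>E. ip y e *c e)" for y
  proof -
    have "y - (\<Sum>e\<in>E. ip y e *c e) \<in> S"
      using orthonormal_coefficient[OF E fin subset_refl]
      by (auto simp: S_def ip_diff_left)
    from zero[OF this] show ?thesis by simp
  qed
  define l where "l e = Re (ip (a e) e)" for e
  have ev: "a e = of_real (l e) *c e" if e: "e \<in> E" for e
  proof -
    obtain m where m: "a e = m *c e" using eig[OF e] by blast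
    have "ip e e = 1" using E e by (simp add: orthonormal_def)
    then have "ip (a e) e = m" "ip e (a e) = cnj m"
      by (simp_all add: m ip_scale_left ip_scale_right)
    with sa[of e e] have "m = cnj m" by simp
    then have "Im m = 0" by (metis Reals_cnj_iff complex_is_Real_iff)
    then have "m = of_real (l e)"
      using \<open>ip (a e) e = m\<close> by (simp add: l_def complex_eq_iff)
    with m show ?thesis by simp
  qed
  have "a y = diagonal_op E l y" for y
  proof -
    have "a y = (\<Sum>e\<in>E. ip y e *c a e)"
      by (subst (1) expand) (simp add: linear_op_sum[OF lin] linear_op_scale[OF lin])
    then show ?thesis by (simp add: diagonal_op_def ev)
  qed
  then show thesis using that[OF E ev] by blast
qed

lemma effect_spectral:
  assumes "self_adjoint a" "op_le (\<lambda>x. 0) a" "op_le a id"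
  obtains E l where "orthonormal E" "l ` E \<subseteq> {0..1}" "a = diagonal_op E l"
proof -
  obtain E l where E: "orthonormal E" and ev: "\<And>e. e \<in> E \<Longrightarrow> a e = of_real (l e) *c e"
    and a: "a = diagonal_op E l"
    using spectral_theorem[OF assms(1)] by blast
  have "0 \<le> l e \<and> l e \<le> 1" if "e \<in> E" for e
  proof -
    have "ip e e = 1" using E that by (simp add: orthonormal_def)
    moreover have "0 \<le> Re (ip (a e) e)" "0 \<le> Re (ip (e - a e) e)"
      using assms(2,3) by (auto simp: op_le_def positive_op_def)
    ultimately show ?thesis by (simp add: ev[OF that] ip_scale_left ip_diff_left)
  qed
  then have "l ` E \<subseteq> {0..1}" by auto
  with E a that show thesis by blast
qed

section \<open>Exchanging weights inside a plane\<close>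

text \<open>A number and its conjugate have opposite imaginary parts, so the imaginary part in question is that
  of \<open>w * (D - cnj C)\<close>, and a phase \<open>w\<close> can rotate one complex number onto the real axis.\<close>

lemma phase_making_real:
  fixes C D :: complex
  obtains w where "cmod w = 1" "Im (cnj w * C + w * D) = 0"
proof -
  define z where "z = D - cnj C"
  have *: "Im (cnj w * C + w * D) = Im (w * z)" for w
    by (simp add: z_def algebra_simps)
  show thesis
  proof (cases "z = 0")
    case True
    show thesis by (rule that[of 1]) (auto simp only: *, auto simp: True)
  next
    case False
    show thesis
    proof (rule that[of "cnj z / of_real (cmod z)"])
      show "cmod (cnj z / of_real (cmod z)) = 1" using False by (simp add: norm_divide)
      have "cnj z / of_real (cmod z) * z = of_real (cmod z)"
        using False complex_norm_square[of z]
        by (simp add: field_simps power2_eq_square)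
      then show "Im (cnj (cnj z / of_real (cmod z)) * C + cnj z / of_real (cmod z) * D) = 0"
        by (simp only: *) simp
    qed
  qed
qed

text \<open>The Toeplitz-Hausdorff theorem for the two-by-two matrix with diagonal entries \<open>A\<close>, \<open>B\<close>,
  written in terms of the unit vector with coordinates \<open>p\<close> and \<open>q * w\<close>. If \<open>A \<noteq> B\<close>, then for a suitable phase \<open>w\<close>, the
  values of the form stay on the line through \<open>A\<close> and \<open>B\<close> while \<open>(p, q)\<close> runs through a quarter of the
  unit circle; they run from \<open>A\<close> to \<open>B\<close>, so every point of the segment is attained by the intermediate
  value theorem.\<close>

lemma quadratic_form_interpolation:
  fixes A B C D :: complex and t :: real
  assumes "0 \<le> t" "t \<le> 1"
  obtains p q :: real and w :: complex where "p\<^sup>2 + q\<^sup>2 = 1" "cmod w = 1"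
    "of_real (p\<^sup>2) * A + of_real (q\<^sup>2) * B + of_real (p * q) * (cnj w * C + w * D)
      = of_real t * A + of_real (1 - t) * B"
proof (cases "A = B")
  case True
  show thesis
    by (rule that[of 1 0 1]) (auto simp: True algebra_simps)
next
  case False
  obtain w where w: "cmod w = 1" "Im (cnj w * (C / (A - B)) + w * (D / (A - B))) = 0"
    using phase_making_real .
  define r where "r = Re (cnj w * (C / (A - B)) + w * (D / (A - B)))"
  have "cnj w * (C / (A - B)) + w * (D / (A - B)) = of_real r"
    using w(2) by (simp add: complex_eq_iff r_def)
  then have "(cnj w * C + w * D) / (A - B) = of_real r"
    by (simp add: add_divide_distrib)
  then have r: "cnj w * C + w * D = of_real r * (A - B)"
    using False by (simp add: field_simps)
  \<comment> \<open>the position on that line, in the coordinate with value 1 at \<open>A\<close> and 0 at \<open>B\<close>\<close>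
  let ?f = "\<lambda>s. (cos s)\<^sup>2 + cos s * sin s * r"
  have "\<exists>s\<ge>0. s \<le> pi / 2 \<and> ?f s = t"
    using assms by (intro IVT2) auto
  then obtain s where s: "?f s = t" by blast
  have "of_real (X\<^sup>2) * A + of_real (Y\<^sup>2) * B + of_real (X * Y) * (of_real r * (A - B))
      = of_real (X\<^sup>2 + X * Y * r) * (A - B) + of_real (X\<^sup>2 + Y\<^sup>2) * B" for X Y :: real
    by (simp add: algebra_simps)
  then have "of_real ((cos s)\<^sup>2) * A + of_real ((sin s)\<^sup>2) * B
      + of_real (cos s * sin s) * (cnj w * C + w * D)
      = of_real (?f s) * (A - B) + of_real ((cos s)\<^sup>2 + (sin s)\<^sup>2) * B"
    by (simp only: r)
  also have "\<dots> = of_real t * A + of_real (1 - t) * B"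
    by (simp only: s) (simp add: algebra_simps)
  finally show thesis
    by (intro that[of "cos s" "sin s" w]) (use w in auto)
qed

text \<open>Besides the unit vector \<open>x\<close> that realises the prescribed value, the vector \<open>y\<close> completing it to
  an orthonormal basis of the plane is recorded. The last equation is the independence of basis of
  the trace of the compression of \<open>c\<close> to that plane. The fourth says, without spans, that \<open>x\<close> and
  \<open>y\<close> lie in the plane as far as orthogonality to other vectors is concerned.\<close>

lemma plane_interpolation:
  assumes c: "linear_op c" and uv: "ip u u = 1" "ip v v = 1" "ip u v = 0"
    and t: "0 \<le> t" "t \<le> 1"
  obtains x y where "ip x x = 1" "ip y y = 1" "ip x y = 0"
    "\<And>z. ip u z = 0 \<Longrightarrow> ip v z = 0 \<Longrightarrow> ip x z = 0 \<and> ip y z = 0"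
    "ip (c x) x = of_real t * ip (c u) u + of_real (1 - t) * ip (c v) v"
    "ip (c x) x + ip (c y) y = ip (c u) u + ip (c v) v"
proof -
  let ?A = "ip (c u) u" and ?B = "ip (c v) v" and ?C = "ip (c u) v" and ?D = "ip (c v) u"
  obtain p q :: real and w :: complex where pq: "p\<^sup>2 + q\<^sup>2 = 1" and w: "cmod w = 1"
    and eq: "of_real (p\<^sup>2) * ?A + of_real (q\<^sup>2) * ?B
        + of_real (p * q) * (cnj w * ?C + w * ?D)
      = of_real t * ?A + of_real (1 - t) * ?B"
    using quadratic_form_interpolation[OF t] .
  have vu: "ip v u = 0" using uv(3) ip_commute[of v u] by simp
  have ww: "w * cnj w = 1" using w complex_norm_square[of w] by simp
  have pq': "of_real p * of_real p + of_real q * of_real q = (1 :: complex)"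
    using pq by (metis of_real_1 of_real_add of_real_mult power2_eq_square)
  define x where "x = of_real p *c u + (of_real q * w) *c v"
  define y where "y = (- (of_real q * cnj w)) *c u + of_real p *c v"
  note expand = ip_add_left ip_add_right ip_scale_left ip_scale_right uv vu
    linear_op_add[OF c] linear_op_scale[OF c] linear_op_diff[OF c] ip_diff_left ip_diff_right
  have cx: "ip (c x) x = of_real p * of_real p * ?A + of_real q * of_real q * (w * cnj w) * ?B
      + of_real p * of_real q * (cnj w * ?C + w * ?D)"
    by (simp add: x_def expand algebra_simps)
  have cy: "ip (c y) y = of_real q * of_real q * (w * cnj w) * ?A + of_real p * of_real p * ?B
      - of_real p * of_real q * (cnj w * ?C + w * ?D)"
    by (simp add: y_def expand algebra_simps)
  show thesis
  proof (rule that[of x y])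
    have "ip x x = of_real p * of_real p + of_real q * of_real q * (w * cnj w)"
      by (simp add: x_def expand algebra_simps)
    then show "ip x x = 1" by (simp add: ww pq')
    have "ip y y = of_real p * of_real p + of_real q * of_real q * (w * cnj w)"
      by (simp add: y_def expand algebra_simps)
    then show "ip y y = 1" by (simp add: ww pq')
    show "ip x y = 0"
      by (simp add: x_def y_def expand algebra_simps)
    show "ip x z = 0 \<and> ip y z = 0" if "ip u z = 0" "ip v z = 0" for z
      using that by (simp add: x_def y_def expand)
    show "ip (c x) x = of_real t * ?A + of_real (1 - t) * ?B"
      using eq unfolding cx ww by (simp add: power2_eq_square)
    have "ip (c x) x + ip (c y) y
        = (of_real p * of_real p + of_real q * of_real q) * (?A + ?B)"
      unfolding cx cy ww by (simp add: algebra_simps)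
    then show "ip (c x) x + ip (c y) y = ?A + ?B" by (simp add: pq')
  qed
qed

text \<open>If \<open>a + b \<le> 1\<close>, the whole weight is moved to one vector \<open>x\<close>, whose value is the weighted mean
  of the values at \<open>u\<close> and \<open>v\<close>. If \<open>a + b > 1\<close>, the same is done with the complementary weights
  \<open>1 - a\<close> and \<open>1 - b\<close>, and the result is subtracted from the trace over the plane.\<close>

lemma plane_exchange:
  assumes c: "linear_op c" and uv: "ip u u = 1" "ip v v = 1" "ip u v = 0"
    and l: "0 < a" "a < 1" "0 < b" "b < (1 :: real)"
  obtains x y \<alpha> \<beta> where "ip x x = 1" "ip y y = 1" "ip x y = 0"
    "\<And>z. ip u z = 0 \<Longrightarrow> ip v z = 0 \<Longrightarrow> ip x z = 0 \<and> ip y z = 0"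
    "\<alpha> + \<beta> = a + b" "0 \<le> \<alpha>" "\<alpha> \<le> 1" "\<beta> = 0 \<or> \<beta> = (1 :: real)"
    "of_real \<alpha> * ip (c x) x + of_real \<beta> * ip (c y) y
      = of_real a * ip (c u) u + of_real b * ip (c v) v"
proof (cases "a + b \<le> 1")
  case True
  let ?t = "a / (a + b)"
  have t: "0 \<le> ?t" "?t \<le> 1" using l by auto
  obtain x y where xy: "ip x x = 1" "ip y y = 1" "ip x y = 0"
    "\<And>z. ip u z = 0 \<Longrightarrow> ip v z = 0 \<Longrightarrow> ip x z = 0 \<and> ip y z = 0"
    and x: "ip (c x) x = of_real ?t * ip (c u) u + of_real (1 - ?t) * ip (c v) v"
    using plane_interpolation[OF c uv t] by metis
  have "(a + b) * ?t = a" "(a + b) * (1 - ?t) = b"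
    using l by (simp_all add: field_simps)
  then have "of_real (a + b) * ip (c x) x = of_real a * ip (c u) u + of_real b * ip (c v) v"
    unfolding x distrib_left mult.assoc[symmetric] of_real_mult[symmetric] by simp
  then show thesis
    using l True by (intro that[OF xy, of "a + b" 0]) auto
next
  case False
  let ?t = "(1 - a) / (2 - (a + b))"
  have t: "0 \<le> ?t" "?t \<le> 1" using l by auto
  obtain x y where xy: "ip x x = 1" "ip y y = 1" "ip x y = 0"
    "\<And>z. ip u z = 0 \<Longrightarrow> ip v z = 0 \<Longrightarrow> ip x z = 0 \<and> ip y z = 0"
    and x: "ip (c x) x = of_real ?t * ip (c u) u + of_real (1 - ?t) * ip (c v) v"
    and tr: "ip (c x) x + ip (c y) y = ip (c u) u + ip (c v) v"
    using plane_interpolation[OF c uv t] by metis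
  have "(2 - (a + b)) * ?t = 1 - a" "(2 - (a + b)) * (1 - ?t) = 1 - b"
    using l by (simp_all add: field_simps)
  then have *: "of_real (2 - (a + b)) * ip (c x) x
      = of_real (1 - a) * ip (c u) u + of_real (1 - b) * ip (c v) v"
    unfolding x distrib_left mult.assoc[symmetric] of_real_mult[symmetric] by simp
  have "of_real (a + b - 1) * ip (c x) x + of_real 1 * ip (c y) y
      = (ip (c x) x + ip (c y) y) - of_real (2 - (a + b)) * ip (c x) x"
    by (simp add: algebra_simps)
  also have "\<dots> = of_real a * ip (c u) u + of_real b * ip (c v) v"
    unfolding tr * by (simp add: algebra_simps)
  finally show thesis
    using l False by (intro that[OF xy, of "a + b - 1" 1]) auto
qed

definition fractional :: "'a set \<Rightarrow> ('a \<Rightarrow> real) \<Rightarrow> 'a set" where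
  "fractional E l = {e \<in> E. 0 < l e \<and> l e < 1}"

lemma exchange_step:
  assumes c: "linear_op c" and E: "orthonormal E" and l: "l ` E \<subseteq> {0..1}"
    and uv: "u \<in> fractional E l" "v \<in> fractional E l" "u \<noteq> v"
  obtains E' l' where "orthonormal E'" "l' ` E' \<subseteq> {0..1}"
    "sum l' E' = sum l E"
    "(\<Sum>e\<in>E'. of_real (l' e) * ip (c e) e) = (\<Sum>e\<in>E. of_real (l e) * ip (c e) e)"
    "card (fractional E' l') < card (fractional E l)"
proof -
  have fin: "finite E" by (rule orthonormal_finite[OF E])
  have uvE: "u \<in> E" "v \<in> E" using uv by (auto simp: fractional_def)
  have uvip: "ip u u = 1" "ip v v = 1" "ip u v = 0"
    using E uvE uv(3) by (auto simp: orthonormal_def)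
  have luv: "0 < l u" "l u < 1" "0 < l v" "l v < 1" using uv by (auto simp: fractional_def)
  obtain x y \<alpha> \<beta> where xy: "ip x x = 1" "ip y y = 1" "ip x y = 0"
    and orth: "\<And>z. ip u z = 0 \<Longrightarrow> ip v z = 0 \<Longrightarrow> ip x z = 0 \<and> ip y z = 0"
    and \<alpha>\<beta>: "\<alpha> + \<beta> = l u + l v" "0 \<le> \<alpha>" "\<alpha> \<le> 1" "\<beta> = 0 \<or> \<beta> = (1 :: real)"
    and val: "of_real \<alpha> * ip (c x) x + of_real \<beta> * ip (c y) y
      = of_real (l u) * ip (c u) u + of_real (l v) * ip (c v) v"
    using plane_exchange[OF c uvip luv] by metis
  define R where "R = E - {u, v}"
  have ER: "E = insert u (insert v R)" "u \<notin> R" "v \<notin> R" "finite R"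
    using uvE fin by (auto simp: R_def)
  have R: "ip x z = 0" "ip y z = 0" if "z \<in> R" for z
    using that E uvE orth[of z] by (auto simp: orthonormal_def R_def)
  have oR: "orthonormal R" using E by (auto simp: orthonormal_def R_def)
  have xyR: "x \<notin> R" "y \<notin> R" "x \<noteq> y" using R xy by fastforce+
  define E' where "E' = insert x (insert y R)"
  define l' where "l' = l(x := \<alpha>, y := \<beta>)"
  have l'R: "l' e = l e" if "e \<in> R" for e using that xyR by (auto simp: l'_def)
  have l'xy: "l' x = \<alpha>" "l' y = \<beta>" using xyR by (auto simp: l'_def)
  have sumE: "sum f E = f u + f v + sum f R" for f :: "'a \<Rightarrow> 'b::comm_monoid_add"
    using ER uv(3) by (simp add: add.assoc)
  have sumE': "sum f E' = f x + f y + sum f R" for f :: "'a \<Rightarrow> 'b::comm_monoid_add"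
    using ER(4) xyR by (simp add: E'_def add.assoc)
  show thesis
  proof (rule that[of E' l'])
    show "orthonormal E'"
      unfolding E'_def using R xy
      by (intro orthonormal_insert oR) auto
    have "l' e \<in> {0..1}" if "e \<in> E'" for e
      using that l'R[of e] l'xy \<alpha>\<beta>(2-4) l ER(1) unfolding E'_def by auto
    then show "l' ` E' \<subseteq> {0..1}" by blast
    show "sum l' E' = sum l E"
      using l'R by (simp add: sumE sumE' l'xy \<alpha>\<beta>)
    show "(\<Sum>e\<in>E'. of_real (l' e) * ip (c e) e) = (\<Sum>e\<in>E. of_real (l e) * ip (c e) e)"
      using l'R by (simp add: sumE sumE' l'xy val)
    have "fractional E' l' \<subseteq> insert x (fractional E l - {u, v})"
      using l'R l'xy \<alpha>\<beta>(4) by (auto simp: fractional_def E'_def R_def)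
    moreover have ff: "finite (fractional E l)" using fin by (simp add: fractional_def)
    ultimately have "card (fractional E' l') \<le> card (insert x (fractional E l - {u, v}))"
      by (intro card_mono) auto
    also have "\<dots> \<le> Suc (card (fractional E l - {u, v}))"
      by (rule card_insert_le_m1) auto
    also have "card (fractional E l - {u, v}) = card (fractional E l) - 2"
      using uv ff by (simp add: card_Diff_subset)
    finally have "card (fractional E' l') \<le> Suc (card (fractional E l) - 2)" .
    moreover have "2 \<le> card (fractional E l)"
      using card_mono[OF ff, of "{u, v}"] uv by simp
    ultimately show "card (fractional E' l') < card (fractional E l)" by linarith
  qed
qed

text \<open>A single fractional weight would differ from the integer \<open>k\<close> by a sum of zeros and ones.\<close>

lemma integral_weight_sum_imp_no_fractional:
  assumes "orthonormal E" "l ` E \<subseteq> {0..1}"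
    and "sum l E = of_nat k" "card (fractional E l) \<le> 1"
  shows "fractional E l = {}"
proof (rule ccontr)
  assume "fractional E l \<noteq> {}"
  have fin: "finite E" by (rule orthonormal_finite[OF assms(1)])
  then have ff: "finite (fractional E l)" by (simp add: fractional_def)
  with \<open>fractional E l \<noteq> {}\<close> assms(4) have "card (fractional E l) = 1"
    by (metis One_nat_def card_0_eq le_SucE le_zero_eq)
  then obtain u where u: "fractional E l = {u}" by (auto simp: card_1_singleton_iff)
  then have uE: "u \<in> E" "0 < l u" "l u < 1" by (auto simp: fractional_def)
  have "l e \<in> \<int>" if "e \<in> E - {u}" for e
  proof -
    have "e \<notin> fractional E l" using u that by auto
    then have "l e = 0 \<or> l e = 1" using that assms(2) by (force simp: fractional_def)
    then show ?thesis by auto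
  qed
  then have "sum l (E - {u}) \<in> \<int>" by (rule Ints_sum)
  moreover have "l u = of_nat k - sum l (E - {u})"
    using assms(3) sum.remove[OF fin uE(1), of l] by simp
  ultimately have "l u \<in> \<int>" by (simp add: Ints_diff)
  then show False using uE by (auto elim!: Ints_cases)
qed

text \<open>Induction on the number of fractional weights: \<open>exchange_step\<close> lowers it as long as it exceeds 1,
  and once all weights are 0 or 1, \<open>F\<close> is the set of vectors of weight 1.\<close>

lemma round_weights_to_subset:
  assumes c: "linear_op c" and "orthonormal E" "l ` E \<subseteq> {0..1}"
    and "sum l E = of_nat k"
  obtains F where "orthonormal F" "card F = k"
    "(\<Sum>e\<in>F. ip (c e) e) = (\<Sum>e\<in>E. of_real (l e) * ip (c e) e)"
proof -
  have "\<exists>F. orthonormal F \<and> card F = k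
    \<and> (\<Sum>e\<in>F. ip (c e) e) = (\<Sum>e\<in>E. of_real (l e) * ip (c e) e)"
    using assms(2-4)
  proof (induction "card (fractional E l)" arbitrary: E l rule: less_induct)
    case less
    have fin: "finite E" by (rule orthonormal_finite[OF less.prems(1)])
    show ?case
    proof (cases "card (fractional E l) \<le> 1")
      case True
      then have empty: "fractional E l = {}"
        using integral_weight_sum_imp_no_fractional[OF less.prems] by simp
      have l01: "l e = 0 \<or> l e = 1" if "e \<in> E" for e
      proof -
        have "\<not> (0 < l e \<and> l e < 1)" using empty that by (auto simp: fractional_def)
        then show ?thesis using less.prems(2) that by force
      qed
      let ?F = "{e \<in> E. l e = 1}"
      have "orthonormal ?F" using less.prems(1) by (auto simp: orthonormal_def)
      moreover have "card ?F = k"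
      proof -
        have "sum l E = (\<Sum>e\<in>E. if l e = 1 then 1 else 0)"
          using l01 by (intro sum.cong) auto
        also have "\<dots> = of_nat (card ?F)" using fin by (simp add: sum.If_cases Int_def)
        finally show ?thesis using less.prems(3) by simp
      qed
      moreover have "(\<Sum>e\<in>?F. ip (c e) e) = (\<Sum>e\<in>E. of_real (l e) * ip (c e) e)"
        using fin l01 by (intro sum.mono_neutral_cong_left) auto
      ultimately show ?thesis by blast
    next
      case False
      moreover have "finite (fractional E l)" using fin by (simp add: fractional_def)
      ultimately obtain u v where uv: "u \<in> fractional E l" "v \<in> fractional E l" "u \<noteq> v"
        using card_le_Suc0_iff_eq[of "fractional E l"] by auto
      show ?thesis
      proof (rule exchange_step[OF c less.prems(1,2) uv])
        fix E' l'
        assume E': "orthonormal E'" "l' ` E' \<subseteq> {0..1}" "sum l' E' = sum l E"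
          "(\<Sum>e\<in>E'. of_real (l' e) * ip (c e) e) = (\<Sum>e\<in>E. of_real (l e) * ip (c e) e)"
          "card (fractional E' l') < card (fractional E l)"
        have "sum l' E' = of_nat k" using E'(3) less.prems(3) by simp
        from less.hyps[OF E'(5,1,2) this] show ?thesis unfolding E'(4) .
      qed
    qed
  qed
  with that show thesis by blast
qed

section \<open>The slice and the numerical range\<close>

text \<open>Sets take the place of orthonormal families here: an orthonormal family is injective, so it
  is determined up to order by its range, and the sum does not depend on the order.\<close>

lemma k_numerical_range_orthonormal_sets:
  "k_numerical_range k c = {1 / of_nat k * (\<Sum>e\<in>F. ip (c e) e) | F. orthonormal F \<and> card F = k}"
proof (intro equalityI subsetI)
  fix z assume "z \<in> k_numerical_range k c"
  then obtain x where z: "z = 1 / of_nat k * (\<Sum>i=1..k. ip (c (x i)) (x i))"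
    and x: "\<forall>i\<in>{1..k}. \<forall>j\<in>{1..k}. ip (x i) (x j) = (if i = j then 1 else 0)"
    unfolding k_numerical_range_def by blast
  have inj: "inj_on x {1..k}"
    using x by (intro inj_onI) (metis zero_neq_one)
  have "orthonormal (x ` {1..k})"
    unfolding orthonormal_def using x inj by (auto simp: inj_on_eq_iff)
  moreover have "card (x ` {1..k}) = k" using inj by (simp add: card_image)
  moreover have "(\<Sum>e\<in>x ` {1..k}. ip (c e) e) = (\<Sum>i=1..k. ip (c (x i)) (x i))"
    unfolding sum.reindex[OF inj] o_def ..
  ultimately show "z \<in> {1 / of_nat k * (\<Sum>e\<in>F. ip (c e) e) | F. orthonormal F \<and> card F = k}"
    unfolding z by (metis (mono_tags, lifting) mem_Collect_eq)
next
  fix z assume "z \<in> {1 / of_nat k * (\<Sum>e\<in>F. ip (c e) e) | F. orthonormal F \<and> card F = k}"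
  then obtain F where z: "z = 1 / of_nat k * (\<Sum>e\<in>F. ip (c e) e)"
    and F: "orthonormal F" "card F = k" by blast
  obtain x where x: "bij_betw x {1..k} F"
    using ex_bij_betw_nat_finite_1[OF orthonormal_finite[OF F(1)]] F(2) by auto
  have "ip (x i) (x j) = (if i = j then 1 else 0)" if "i \<in> {1..k}" "j \<in> {1..k}" for i j
    using x that F(1) by (auto simp: orthonormal_def bij_betw_def inj_on_eq_iff)
  moreover have "(\<Sum>e\<in>F. ip (c e) e) = (\<Sum>i=1..k. ip (c (x i)) (x i))"
    by (rule sum.reindex_bij_betw[OF x, symmetric])
  ultimately show "z \<in> k_numerical_range k c"
    unfolding z k_numerical_range_def by auto
qed

text \<open>The spectral theorem, read in one direction for the operators \<open>0 \<le> a \<le> 1\<close>; Bessel's inequality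
  gives the other direction.\<close>

lemma spectral_scale_orthonormal:
  assumes "linear_op c"
  shows "spectral_scale c = {(sum l E / real (dim (UNIV :: 'a set)),
      (\<Sum>e\<in>E. of_real (l e) * ip (c e) e) / of_nat (dim (UNIV :: 'a set))) | E l.
      orthonormal E \<and> l ` E \<subseteq> {0..1}}" (is "_ = ?R")
proof -
  have Psi: "Psi c (diagonal_op E l) = (sum l E / real (dim (UNIV :: 'a set)),
      (\<Sum>e\<in>E. of_real (l e) * ip (c e) e) / of_nat (dim (UNIV :: 'a set)))"
    if "orthonormal E" for E l
    using that assms
    by (simp add: Psi_def ntrace_def op_trace_diagonal_op op_trace_compose_diagonal_op
        Re_divide_of_nat del: of_real_sum)
  show ?thesis
  proof (intro equalityI subsetI)
    fix z assume "z \<in> spectral_scale c"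
    then obtain a where z: "z = Psi c a" and a: "self_adjoint a" "op_le (\<lambda>x. 0) a" "op_le a id"
      by (auto simp: spectral_scale_def)
    obtain E l where "orthonormal E" "l ` E \<subseteq> {0..1}" "a = diagonal_op E l"
      using effect_spectral[OF a] by blast
    then show "z \<in> ?R" using z Psi by blast
  next
    fix z assume "z \<in> ?R"
    then obtain E l where z: "z = Psi c (diagonal_op E l)"
      and E: "orthonormal E" "l ` E \<subseteq> {0..1}"
      using Psi by force
    then show "z \<in> spectral_scale c"
      using diagonal_op_effect[OF E] self_adjoint_diagonal_op[of E l]
      unfolding spectral_scale_def by blast
  qed
qed

lemma slice_map_image_k_numerical_range:
  assumes c: "linear_op c" and n: "dim (UNIV :: 'a set) = n" "0 < k" "0 < n"
  shows "slice_map n k ` k_numerical_range k c = isotrace_slice c (real k / real n)"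
proof (intro equalityI subsetI)
  fix z assume "z \<in> slice_map n k ` k_numerical_range k c"
  then obtain F where F: "orthonormal F" "card F = k"
    and z: "z = slice_map n k (1 / of_nat k * (\<Sum>e\<in>F. ip (c e) e))"
    unfolding k_numerical_range_orthonormal_sets by blast
  have "z = (real k / real n, (\<Sum>e\<in>F. ip (c e) e) / of_nat n)"
    using n by (simp add: z slice_map_def)
  moreover have "(real k / real n, (\<Sum>e\<in>F. ip (c e) e) / of_nat n) \<in> spectral_scale c"
    unfolding spectral_scale_orthonormal[OF c] n(1)
    using F by (intro CollectI exI[of _ F] exI[of _ "\<lambda>_. 1"]) auto
  ultimately show "z \<in> isotrace_slice c (real k / real n)"
    by (simp add: isotrace_slice_def)
next
  fix z assume "z \<in> isotrace_slice c (real k / real n)"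
  then obtain E l where E: "orthonormal E" "l ` E \<subseteq> {0..1}"
    and z: "z = (sum l E / real n, (\<Sum>e\<in>E. of_real (l e) * ip (c e) e) / of_nat n)"
    and tr: "sum l E / real n = real k / real n"
    unfolding isotrace_slice_def spectral_scale_orthonormal[OF c] n(1) by blast
  from tr n have "sum l E = of_nat k" by simp
  then obtain F where F: "orthonormal F" "card F = k"
    "(\<Sum>e\<in>F. ip (c e) e) = (\<Sum>e\<in>E. of_real (l e) * ip (c e) e)"
    using round_weights_to_subset[OF c E, of k] by blast
  have "z = slice_map n k (1 / of_nat k * (\<Sum>e\<in>F. ip (c e) e))"
    using n by (simp add: z slice_map_def F(3) tr)
  then show "z \<in> slice_map n k ` k_numerical_range k c"
    unfolding k_numerical_range_orthonormal_sets using F by blast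
qed

end

lemma affine_map_slice_map: "affine_map (slice_map n k)"
proof -
  have "linear (\<lambda>l :: complex. (0 :: real, of_nat k * l / of_nat n))"
    by (rule linearI) (auto simp: algebra_simps add_divide_distrib scaleR_conv_of_real)
  then show ?thesis
    unfolding affine_map_def
    by (intro exI[of _ "\<lambda>l. (0, of_nat k * l / of_nat n)"] exI[of _ "(real k / real n, 0)"])
      (auto simp: slice_map_def)
qed

theorem theorem1p3:
  fixes scale :: "complex \<Rightarrow> 'a::ab_group_add \<Rightarrow> 'a"
    and Basis :: "'a set"
    and ip :: "'a \<Rightarrow> 'a \<Rightarrow> complex"
    and c :: "'a \<Rightarrow> 'a"
    and n k :: nat
  assumes "complex_hilbert scale Basis ip"
    and "vector_space.dim scale (UNIV :: 'a set) = n"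
    and "Vector_Spaces.linear scale scale c"
    and "0 < k" and "k < n"
  shows "affine_map (slice_map n k) \<and>
    bij_betw (slice_map n k)
      (complex_hilbert.k_numerical_range ip k c)
      (complex_hilbert.isotrace_slice scale Basis ip c (real k / real n))"
proof -
  interpret complex_hilbert scale Basis ip by (rule assms(1))
  have "linear_op c" using assms(3) by (simp add: linear_op_def)
  then have "slice_map n k ` k_numerical_range k c = isotrace_slice c (real k / real n)"
    using assms by (intro slice_map_image_k_numerical_range) auto
  moreover have "inj_on (slice_map n k) (k_numerical_range k c)"
    using assms(4,5) by (auto simp: inj_on_def slice_map_def)
  ultimately show ?thesis
    by (simp add: bij_betw_def affine_map_slice_map)
qed

end
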